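(* Let $\lambda_0\in\mathbb{R}$. If an approximate design $d$ with $P_d=(p_s)_{s\in{\cal S}}$ satisfies $$\sum_{s\in{\cal R}}p_s[\hat A_{s11}+x_0\hat A_{s12}]=\frac{y_0}{t-1}B_t,\qquad \sum_{s\in{\cal R}}p_s[\hat A_{s21}+x_0\hat A_{s22}]=0,$$ $$\sum_{s\in{\cal R}}p_s\tilde B\,[F_s+x_0(T_s+\lambda_0F_s)]B_t=0,\qquad \sum_{s\in{\cal R}}p_s=1,\qquad p_s=0\ \text{ if } s\notin{\cal R},$$ then for every $\tau_0$, $d$ maximizes $\varphi_{\delta_{\tau_0},\lambda_0}$ over all approximate designs.
   Context: Fix integers $p\ge2$ (periods), $t\ge2$ (treatments), $n\ge1$ (subjects) and a symmetric positive definite real $p\times p$ matrix $\Sigma$ (within-subject covariance). $1_k$ is the all-ones vector of length $k$, $J_k=1_k1_k'$, $B_k=I_k-J_k/k$, prime denotes transpose, and $\tilde B=\Sigma^{-1}-\Sigma^{-1}J_p\Sigma^{-1}/(1_p'\Sigma^{-1}1_p)$. Let ${\cal S}=\{1,\dots,t\}^p$ be the set of treatment sequences. For $s=(t_1,\dots,t_p)\in{\cal S}$, $T_s$ is the $p\times t$ matrix with $(k,i)$ entry $1$ if $t_k=i$ and $0$ otherwise; $F_s$ is the $p\times t$ matrix with zero first row and, for $k\ge2$, $(k,i)$ entry $1$ if $t_{k-1}=i$ and $0$ otherwise. An (approximate) design $d$ is a vector $P_d=(p_s)_{s\in{\cal S}}$ with $p_s\ge0$, $\sum_sp_s=1$.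 For $1\le i,j\le2$ put $\hat A_{sij}=B_tG_{s,i}'\tilde BG_{s,j}B_t$ with $G_{s,1}=F_s$, $G_{s,2}=T_s+\lambda_0F_s$; $\hat A_{dij}=n\sum_sp_s\hat A_{sij}$; $A_{dij}=\hat A_{dij}-nG_i'\tilde BG_j$ with $G_1=\sum_sp_sF_sB_t$, $G_2=\sum_sp_s(T_s+\lambda_0F_s)B_t$; and $A_d=A_{d11}-A_{d12}A_{d22}^-A_{d21}$ ($^-$ denotes a generalized inverse). In the proportional model (carryover effects equal $\lambda$ times direct effects $\tau$), the information for $\lambda$ at $(\tau_0,\lambda_0)$ is $\tau_0'A_d\tau_0$. For $\tau_0\in\mathbb{R}^t$, $\delta_{\tau_0}$ is the uniform distribution on the set of all coordinate permutations of $\tau_0$, and $\varphi_{\delta_{\tau_0},\lambda_0}(d)=\mathbb{E}[v'A_dv]$ with $v\sim\delta_{\tau_0}$. Let $h_{sij}=\mathrm{tr}(\hat A_{sij})$, $r_s(x)=h_{s11}+2h_{s12}x+h_{s22}x^2$, $r(x)=\max_{s\in{\cal S}}r_s(x)$, $y_0=\min_{x\in\mathbb{R}}r(x)$; $x_0$ is the solution of $r(x)=y_0$, which is taken (standing assumption) to be unique; ${\cal R}=\{s\in{\cal S}:r_s(x_0)=y_0\}$. *)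

theory Defs
  imports "HOL-Analysis.Analysis" "HOL-Probability.Probability"
begin

text \<open>
  The \<open>p\<close> periods are the elements of a finite linearly ordered type \<open>'p\<close>, in their order,
  and the \<open>t\<close> treatments are the elements of a finite type \<open>'t\<close>. A treatment sequence is a
  function \<open>s :: 'p \<Rightarrow> 't\<close>, and the set of all sequences is \<open>UNIV\<close>. A real \<open>p \<times> t\<close> matrix has
  type \<open>('p, 't) rmat\<close>, which is \<open>real^'t^'p\<close> without the sort constraints which that
  notation adds to its type variables.
\<close>

type_synonym ('p, 't) rmat = "((real, 't) vec, 'p) vec"

definition pos_def :: "real^'n^'n \<Rightarrow> bool" where
  "pos_def M \<longleftrightarrow> (\<forall>x. x \<noteq> 0 \<longrightarrow> x \<bullet> (M *v x) > 0)"

definition is_ginverse :: "real^'n^'m \<Rightarrow> real^'m^'n \<Rightarrow> bool" where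
  "is_ginverse M X \<longleftrightarrow> M ** X ** M = M"

lemma ginverse_exists: "\<exists>X. is_ginverse (M :: real^'n^'m) X"
proof -
  obtain g where g: "linear g" "\<And>v. v \<in> range ((*v) M) \<Longrightarrow> M *v g v = v"
    using linear_exists_right_inverse_on[of "(*v) M" UNIV] matrix_vector_mul_linear[of M]
    by auto
  have "M ** matrix g ** M = M"
    unfolding matrix_eq
    using g(2) matrix_vector_mul(2)[OF g(1)] by (simp add: matrix_vector_mul_assoc[symmetric])
  then show ?thesis
    unfolding is_ginverse_def by blast
qed

definition ones_mat :: "real^'n^'n" where
  "ones_mat = (\<chi> i j. 1)"

definition centering_mat :: "real^'n^'n" where
  "centering_mat = mat 1 - (1 / real CARD('n)) *\<^sub>R ones_mat"

text \<open>In the denominator, \<open>1 :: real^'p\<close> is the all-ones vector.\<close>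

definition Btilde :: "('p::finite, 'p) rmat \<Rightarrow> ('p, 'p) rmat" where
  "Btilde \<Sigma> = matrix_inv \<Sigma> -
     (1 / (1 \<bullet> (matrix_inv \<Sigma> *v 1))) *\<^sub>R (matrix_inv \<Sigma> ** ones_mat ** matrix_inv \<Sigma>)"

definition treatment_mat :: "('p::finite \<Rightarrow> 't::finite) \<Rightarrow> ('p, 't) rmat" where
  "treatment_mat s = (\<chi> k i. if s k = i then 1 else 0)"

text \<open>The period preceding a non-initial period \<open>k\<close> is \<open>Max {j. j < k}\<close>.\<close>

definition carryover_mat :: "('p::{finite,linorder} \<Rightarrow> 't::finite) \<Rightarrow> ('p, 't) rmat" where
  "carryover_mat s =
     (\<chi> k i. if (\<exists>j. j < k) \<and> s (Max {j. j < k}) = i then 1 else 0)"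

text \<open>The indices \<open>i, j\<close> below range over \<open>{1, 2}\<close>.\<close>

definition Gmat :: "real \<Rightarrow> ('p::{finite,linorder} \<Rightarrow> 't::finite) \<Rightarrow> nat \<Rightarrow> ('p, 't) rmat" where
  "Gmat lam0 s i =
     (if i = 1 then carryover_mat s else treatment_mat s + lam0 *\<^sub>R carryover_mat s)"

definition Ahat_seq ::
  "('p::{finite,linorder}, 'p) rmat \<Rightarrow> real \<Rightarrow> ('p \<Rightarrow> 't::finite) \<Rightarrow> nat \<Rightarrow> nat \<Rightarrow> ('t, 't) rmat" where
  "Ahat_seq \<Sigma> lam0 s i j =
     centering_mat ** transpose (Gmat lam0 s i) ** Btilde \<Sigma> ** Gmat lam0 s j ** centering_mat"

definition is_design :: "(('p::finite \<Rightarrow> 't::finite) \<Rightarrow> real) \<Rightarrow> bool" where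
  "is_design P \<longleftrightarrow> (\<forall>s. 0 \<le> P s) \<and> (\<Sum>s\<in>UNIV. P s) = 1"

definition Ahat_design ::
  "('p::{finite,linorder}, 'p) rmat \<Rightarrow> real \<Rightarrow> nat \<Rightarrow> (('p \<Rightarrow> 't::finite) \<Rightarrow> real) \<Rightarrow>
     nat \<Rightarrow> nat \<Rightarrow> ('t, 't) rmat" where
  "Ahat_design \<Sigma> lam0 n P i j = real n *\<^sub>R (\<Sum>s\<in>UNIV. P s *\<^sub>R Ahat_seq \<Sigma> lam0 s i j)"

definition Gmean ::
  "real \<Rightarrow> (('p::{finite,linorder} \<Rightarrow> 't::finite) \<Rightarrow> real) \<Rightarrow> nat \<Rightarrow> ('p, 't) rmat" where
  "Gmean lam0 P i = (\<Sum>s\<in>UNIV. P s *\<^sub>R (Gmat lam0 s i ** centering_mat))"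

definition A_block ::
  "('p::{finite,linorder}, 'p) rmat \<Rightarrow> real \<Rightarrow> nat \<Rightarrow> (('p \<Rightarrow> 't::finite) \<Rightarrow> real) \<Rightarrow>
     nat \<Rightarrow> nat \<Rightarrow> ('t, 't) rmat" where
  "A_block \<Sigma> lam0 n P i j =
     Ahat_design \<Sigma> lam0 n P i j -
     real n *\<^sub>R (transpose (Gmean lam0 P i) ** Btilde \<Sigma> ** Gmean lam0 P j)"

text \<open>The parameter \<open>ginv\<close> is the choice of a generalized inverse for every matrix.\<close>

definition A_design ::
  "(('t::finite, 't) rmat \<Rightarrow> ('t, 't) rmat) \<Rightarrow> ('p::{finite,linorder}, 'p) rmat \<Rightarrow> real \<Rightarrow> nat \<Rightarrow>
     (('p \<Rightarrow> 't) \<Rightarrow> real) \<Rightarrow> ('t, 't) rmat" where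
  "A_design ginv \<Sigma> lam0 n P =
     A_block \<Sigma> lam0 n P 1 1 -
     A_block \<Sigma> lam0 n P 1 2 ** ginv (A_block \<Sigma> lam0 n P 2 2) ** A_block \<Sigma> lam0 n P 2 1"

definition coord_perms :: "real^'t \<Rightarrow> (real^'t) set" where
  "coord_perms \<tau> = {\<chi> i. \<tau> $ \<pi> i | \<pi>. \<pi> permutes UNIV}"

definition criterion ::
  "(('t::finite, 't) rmat \<Rightarrow> ('t, 't) rmat) \<Rightarrow> ('p::{finite,linorder}, 'p) rmat \<Rightarrow> (real, 't) vec \<Rightarrow>
     real \<Rightarrow> nat \<Rightarrow> (('p \<Rightarrow> 't) \<Rightarrow> real) \<Rightarrow> real" where
  "criterion ginv \<Sigma> \<tau>0 lam0 n P =
     measure_pmf.expectation (pmf_of_set (coord_perms \<tau>0))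
       (\<lambda>v. v \<bullet> (A_design ginv \<Sigma> lam0 n P *v v))"

definition h_seq ::
  "('p::{finite,linorder}, 'p) rmat \<Rightarrow> real \<Rightarrow> ('p \<Rightarrow> 't::finite) \<Rightarrow> nat \<Rightarrow> nat \<Rightarrow> real" where
  "h_seq \<Sigma> lam0 s i j = trace (Ahat_seq \<Sigma> lam0 s i j)"

definition r_seq ::
  "('p::{finite,linorder}, 'p) rmat \<Rightarrow> real \<Rightarrow> ('p \<Rightarrow> 't::finite) \<Rightarrow> real \<Rightarrow> real" where
  "r_seq \<Sigma> lam0 s x = h_seq \<Sigma> lam0 s 1 1 + 2 * h_seq \<Sigma> lam0 s 1 2 * x + h_seq \<Sigma> lam0 s 2 2 * x\<^sup>2"

text \<open>The type argument supplies the set of treatments, which does not occur in \<open>\<Sigma>\<close>.\<close>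

definition r_max ::
  "'t::finite itself \<Rightarrow> ('p::{finite,linorder}, 'p) rmat \<Rightarrow> real \<Rightarrow> real \<Rightarrow> real" where
  "r_max T \<Sigma> lam0 x = Max (range (\<lambda>s :: 'p \<Rightarrow> 't. r_seq \<Sigma> lam0 s x))"

definition R_seqs ::
  "('p::{finite,linorder}, 'p) rmat \<Rightarrow> real \<Rightarrow> real \<Rightarrow> real \<Rightarrow> ('p \<Rightarrow> 't::finite) set" where
  "R_seqs \<Sigma> lam0 x0 y0 = {s. r_seq \<Sigma> lam0 s x0 = y0}"

end

theory Submission
  imports Defs
begin

text \<open>
  For every \<open>x\<close> the form of the Schur complement \<open>A\<^sub>d\<close> is bounded by that of
  \<open>A\<^sub>d\<^sub>1\<^sub>1 + x (A\<^sub>d\<^sub>1\<^sub>2 + A\<^sub>d\<^sub>2\<^sub>1) + x\<^sup>2 A\<^sub>d\<^sub>2\<^sub>2\<close>, and dropping the mean correction only increases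
  the latter. Averaging a form that vanishes at the all-ones vector over the
  permutation orbit of \<open>\<tau>\<^sub>0\<close> gives a fixed nonnegative multiple of its trace, which at
  \<open>x = x\<^sub>0\<close> is at most \<open>n y\<^sub>0\<close>. Under the hypotheses on \<open>P\<close> the mean corrections to
  \<open>A\<^sub>d\<^sub>1\<^sub>1 + x\<^sub>0 A\<^sub>d\<^sub>1\<^sub>2\<close> and \<open>A\<^sub>d\<^sub>2\<^sub>1 + x\<^sub>0 A\<^sub>d\<^sub>2\<^sub>2\<close> vanish, so \<open>A\<^sub>d\<close> is a multiple of
  \<open>B\<^sub>t\<close> with trace \<open>n y\<^sub>0\<close>.
\<close>

section \<open>Bilinear forms, traces and the centering matrix\<close>

lemma inner_transpose_mult: "x \<bullet> (transpose A *v y) = (A *v x) \<bullet> y"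
  for A :: "real^'n^'m"
  by (metis dot_lmul_matrix vector_transpose_matrix)

lemma inner_mult_symmetric:
  fixes B :: "real^'n^'n"
  assumes "transpose B = B"
  shows "x \<bullet> (B *v y) = y \<bullet> (B *v x)"
  using inner_transpose_mult[of x B y] assms by (simp add: inner_commute)

lemma sum_mult_vector: "(\<Sum>i\<in>I. f i) *v x = (\<Sum>i\<in>I. f i *v x)"
  for f :: "'i \<Rightarrow> real^'n^'m"
  by (induction I rule: infinite_finite_induct) (auto simp: matrix_vector_mult_add_rdistrib)

lemma matrix_eq_bilinear:
  fixes A A' :: "real^'n^'m"
  assumes "\<And>x y. x \<bullet> (A *v y) = x \<bullet> (A' *v y)"
  shows "A = A'"
proof -
  have "A *v y = A' *v y" for y
    by (metis assms inner_commute vector_eq_rdot)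
  then show ?thesis by (simp add: matrix_eq)
qed

lemma trace_scaleR: "trace (c *\<^sub>R A) = c * trace A" for A :: "real^'n^'n"
  by (simp add: trace_def sum_distrib_left)

lemma trace_sum: "trace (\<Sum>i\<in>I. f i) = (\<Sum>i\<in>I. trace (f i))" for f :: "'i \<Rightarrow> real^'n^'n"
  by (induction I rule: infinite_finite_induct) (auto simp: trace_add, simp_all add: trace_def)

lemma transpose_diff: "transpose (A - B) = transpose A - transpose B" for A :: "real^'n^'m"
  by (simp add: transpose_def vec_eq_iff)

lemma transpose_ones_mat: "transpose ones_mat = (ones_mat :: real^'n^'n)"
  by (simp add: transpose_def ones_mat_def)

lemma transpose_centering_mat: "transpose centering_mat = (centering_mat :: real^'n^'n)"
  by (simp add: centering_mat_def transpose_diff transpose_scalar transpose_ones_mat)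

lemma ones_mat_mult_vector: "ones_mat *v x = (1 \<bullet> x) *\<^sub>R (1 :: real^'n)"
  by (simp add: vec_eq_iff matrix_vector_mult_def ones_mat_def inner_vec_def)

lemma centering_mat_one: "centering_mat *v 1 = (0 :: real^'n)"
  by (simp add: centering_mat_def matrix_vector_mult_diff_rdistrib
      scaleR_matrix_vector_assoc[symmetric]
      ones_mat_mult_vector inner_vec_def)

lemma trace_centering_mat: "trace (centering_mat :: real^'n^'n) = real CARD('n) - 1"
  by (simp add: trace_def centering_mat_def ones_mat_def mat_def sum_subtractf field_simps)

section \<open>Positive semidefiniteness of \<open>Btilde\<close>\<close>

text \<open>A positive definite matrix has trivial kernel, hence is invertible; substituting
  \<open>x = \<Sigma> *v y\<close> turns the form of the inverse into that of
  \<open>\<Sigma>\<close>.\<close>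

lemma matrix_inv_pos_def:
  fixes \<Sigma> :: "real^'n^'n"
  assumes sym: "transpose \<Sigma> = \<Sigma>" and pos: "pos_def \<Sigma>"
  shows "transpose (matrix_inv \<Sigma>) = matrix_inv \<Sigma>"
    and "0 \<le> x \<bullet> (matrix_inv \<Sigma> *v x)"
proof -
  have "x = 0" if "\<Sigma> *v x = 0" for x
    using pos that by (force simp: pos_def_def)
  then have "invertible \<Sigma>"
    by (metis invertible_left_inverse matrix_left_invertible_ker)
  then have inv: "\<Sigma> ** matrix_inv \<Sigma> = mat 1" "matrix_inv \<Sigma> ** \<Sigma> = mat 1"
    using someI_ex[of "\<lambda>A'. \<Sigma> ** A' = mat 1 \<and> A' ** \<Sigma> = mat 1"]
    by (simp_all add: invertible_def matrix_inv_def)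
  have "transpose (matrix_inv \<Sigma>) ** \<Sigma> = mat 1"
    by (metis inv(1) sym matrix_transpose_mul transpose_mat)
  then show tr: "transpose (matrix_inv \<Sigma>) = matrix_inv \<Sigma>"
    by (metis inv(1) matrix_mul_assoc matrix_mul_lid matrix_mul_rid)
  define y where "y = matrix_inv \<Sigma> *v x"
  have x: "x = \<Sigma> *v y"
    by (simp add: y_def matrix_vector_mul_assoc inv)
  have "x \<bullet> (matrix_inv \<Sigma> *v x) = y \<bullet> (\<Sigma> *v y)"
    by (metis x y_def inner_commute)
  also have "\<dots> \<ge> 0"
    using pos by (cases "y = 0") (auto simp: pos_def_def less_imp_le)
  finally show "0 \<le> x \<bullet> (matrix_inv \<Sigma> *v x)" .
qed

lemma transpose_Btilde:
  fixes \<Sigma> :: "('p::finite, 'p) rmat"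
  assumes "transpose \<Sigma> = \<Sigma>" and "pos_def \<Sigma>"
  shows "transpose (Btilde \<Sigma>) = Btilde \<Sigma>"
  by (simp add: Btilde_def transpose_diff transpose_scalar matrix_transpose_mul
      matrix_inv_pos_def(1)[OF assms] transpose_ones_mat matrix_mul_assoc)

text \<open>The form of \<open>Btilde \<Sigma>\<close> at \<open>x\<close> is the form of the
  inverse of \<open>\<Sigma>\<close> at the residual of \<open>x\<close> after projection onto the
  all-ones vector, in the inner product given by that inverse.\<close>

lemma Btilde_nonneg:
  fixes \<Sigma> :: "('p::finite, 'p) rmat"
  assumes "transpose \<Sigma> = \<Sigma>" and "pos_def \<Sigma>"
  shows "0 \<le> x \<bullet> (Btilde \<Sigma> *v x)"
proof -
  define S where "S = matrix_inv \<Sigma>"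
  note S = matrix_inv_pos_def[OF assms, folded S_def]
  define a b where "a = 1 \<bullet> (S *v 1)" and "b = 1 \<bullet> (S *v x)"
  have b': "x \<bullet> (S *v 1) = b"
    unfolding b_def by (rule inner_mult_symmetric[OF S(1)])
  have "0 \<le> (x - (b / a) *\<^sub>R 1) \<bullet> (S *v (x - (b / a) *\<^sub>R 1))"
    by (rule S(2))
  also have "\<dots> = x \<bullet> (S *v x) - b / a * b - b / a * b + (b / a) * (b / a) * a"
    by (simp add: matrix_vector_mult_diff_distrib matrix_vector_mult_scaleR inner_diff_left
        inner_diff_right b' flip: a_def b_def)
  \<comment> \<open>If \<open>a = 0\<close>, all quotients by \<open>a\<close> are 0 by convention
    and the two sides agree.\<close>
  also have "\<dots> = x \<bullet> (S *v x) - 1 / a * (b * b)"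
    by (cases "a = 0") (auto simp: field_simps)
  also have "\<dots> = x \<bullet> (Btilde \<Sigma> *v x)"
    by (simp add: Btilde_def S_def[symmetric] a_def[symmetric] matrix_vector_mult_diff_rdistrib
        scaleR_matrix_vector_assoc[symmetric] inner_diff_right matrix_vector_mul_assoc[symmetric]
        ones_mat_mult_vector
        matrix_vector_mult_scaleR b' flip: b_def)
  finally show ?thesis .
qed

section \<open>Schur complement and variance inequalities\<close>

text \<open>Completing the square in \<open>w\<close>: for a solution \<open>u\<close> of
  \<open>A22 *v u = A21 *v v\<close>, the right side exceeds the left by the form of
  \<open>A22\<close> at \<open>u + w\<close>. The generalized inverse supplies such a
  \<open>u\<close>.\<close>

lemma schur_complement_le:
  fixes A11 A12 A21 A22 X :: "real^'n^'n"
  assumes tr: "transpose A12 = A21" and sym: "transpose A22 = A22"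
    and nonneg: "\<And>v w. 0 \<le> v \<bullet> (A11 *v v) + 2 * (v \<bullet> (A12 *v w)) + w \<bullet> (A22 *v w)"
    and X: "is_ginverse A22 X"
  shows "v \<bullet> ((A11 - A12 ** X ** A21) *v v)
    \<le> v \<bullet> (A11 *v v) + 2 * (v \<bullet> (A12 *v w)) + w \<bullet> (A22 *v w)"
proof -
  have cross: "w \<bullet> (A21 *v v) = v \<bullet> (A12 *v w)" for v w
    using inner_transpose_mult[of w A12 v] by (simp add: tr inner_commute)
  have X_tr: "A22 ** transpose X ** A22 = A22"
    using arg_cong[OF X[unfolded is_ginverse_def], of transpose]
    by (simp add: matrix_transpose_mul sym matrix_mul_assoc)
  txt \<open>A kernel vector of \<open>A22\<close> is orthogonal to the range of \<open>A21\<close>: otherwise the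
    nonnegative form would be affine and nonconstant along it.\<close>
  have ker: "v \<bullet> (A12 *v y) = 0" if y: "A22 *v y = 0" for v y
  proof (rule ccontr)
    assume ne: "v \<bullet> (A12 *v y) \<noteq> 0"
    \<comment> \<open>The quadratic term vanishes along \<open>y\<close>, and \<open>c\<close> makes
      the remaining affine expression equal to -1.\<close>
    define q c where "q = v \<bullet> (A11 *v v)" and "c = - (q + 1) / (2 * (v \<bullet> (A12 *v y)))"
    have "0 \<le> q + 2 * (v \<bullet> (A12 *v (c *\<^sub>R y))) + (c *\<^sub>R y) \<bullet> (A22 *v (c *\<^sub>R y))"
      unfolding q_def by (rule nonneg)
    also have "\<dots> = -1"
      using ne by (simp add: matrix_vector_mult_scaleR y c_def field_simps)
    finally show False by simp
  qed
  define u where "u = X *v (A21 *v v)"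
  have "z \<bullet> (A22 *v u) = z \<bullet> (A21 *v v)" for z
  proof -
    \<comment> \<open>\<open>y\<close> is a kernel vector of \<open>A22\<close>, because
      \<open>transpose X\<close> is again a generalized inverse of \<open>A22\<close>. Hence
      \<open>y\<close> is orthogonal to \<open>A21 *v v\<close>.\<close>
    define y where "y = z - transpose X *v (A22 *v z)"
    have "A22 *v y = 0"
      using arg_cong[OF X_tr, of "\<lambda>M. M *v z"]
      by (simp add: y_def matrix_vector_mult_diff_distrib matrix_vector_mul_assoc[symmetric]
          del: transpose_matrix_vector)
    then have "y \<bullet> (A21 *v v) = 0"
      by (simp add: cross ker)
    then have "z \<bullet> (A21 *v v) = (transpose X *v (A22 *v z)) \<bullet> (A21 *v v)"
      by (simp add: y_def inner_diff_left)
    also have "\<dots> = (A22 *v z) \<bullet> u"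
      using inner_transpose_mult[of "A21 *v v" X "A22 *v z"] by (simp add: u_def inner_commute)
    also have "\<dots> = z \<bullet> (A22 *v u)"
      using inner_transpose_mult[of z A22 u] by (simp add: sym)
    finally show ?thesis ..
  qed
  note u = this
  \<comment> \<open>Taking \<open>v = 0\<close> in the nonnegative form shows that
    \<open>A22\<close> is positive semidefinite.\<close>
  have "0 \<le> (u + w) \<bullet> (A22 *v (u + w))"
    using nonneg[of 0 "u + w"] by simp
  also have "\<dots> = u \<bullet> (A22 *v u) + 2 * (w \<bullet> (A22 *v u)) + w \<bullet> (A22 *v w)"
    using inner_mult_symmetric[OF sym, of u w]
    by (simp add: matrix_vector_right_distrib inner_add_left inner_add_right)
  also have "\<dots> = v \<bullet> (A12 *v u) + 2 * (v \<bullet> (A12 *v w)) + w \<bullet> (A22 *v w)"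
    by (simp add: u cross)
  finally show ?thesis
    by (simp add: matrix_vector_mult_diff_rdistrib inner_diff_right u_def
        matrix_vector_mul_assoc[symmetric])
qed

text \<open>A weighted variance is nonnegative: the gap is the weighted sum of the forms of the
  deviations \<open>g s - m\<close>. Since the weights sum to 1, the cross terms contribute -2 times
  the form at \<open>m\<close>.\<close>

lemma weighted_covariance:
  fixes B :: "real^'n^'n" and g :: "'s::finite \<Rightarrow> real^'n"
  assumes sym: "transpose B = B" and nonneg: "\<And>x. 0 \<le> x \<bullet> (B *v x)"
    and w: "(\<Sum>s\<in>UNIV. w s) = 1" "\<And>s. 0 \<le> w s"
  defines "m \<equiv> \<Sum>s\<in>UNIV. w s *\<^sub>R g s"
  shows "m \<bullet> (B *v m) \<le> (\<Sum>s\<in>UNIV. w s * (g s \<bullet> (B *v g s)))"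
proof -
  have "0 \<le> (\<Sum>s\<in>UNIV. w s * ((g s - m) \<bullet> (B *v (g s - m))))"
    by (intro sum_nonneg mult_nonneg_nonneg w nonneg)
  also have "\<dots> = (\<Sum>s\<in>UNIV. w s * (g s \<bullet> (B *v g s)) - 2 * ((w s *\<^sub>R g s) \<bullet> (B *v m))
      + w s * (m \<bullet> (B *v m)))"
  proof (intro sum.cong refl)
    fix s
    show "w s * ((g s - m) \<bullet> (B *v (g s - m))) =
        w s * (g s \<bullet> (B *v g s)) - 2 * ((w s *\<^sub>R g s) \<bullet> (B *v m)) + w s * (m \<bullet> (B *v m))"
      using inner_mult_symmetric[OF sym, of m "g s"]
      by (simp add: matrix_vector_mult_diff_distrib inner_diff_left inner_diff_right algebra_simps)
  qed
  also have "\<dots> = (\<Sum>s\<in>UNIV. w s * (g s \<bullet> (B *v g s))) - 2 * (m \<bullet> (B *v m)) + m \<bullet> (B *v m)"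
  proof -
    have "(\<Sum>s\<in>UNIV. (w s *\<^sub>R g s) \<bullet> (B *v m)) = m \<bullet> (B *v m)"
      unfolding m_def by (simp only: inner_sum_left)
    then show ?thesis
      by (simp only: sum.distrib sum_subtractf w mult_1 flip: sum_distrib_left sum_distrib_right)
  qed
  finally show ?thesis by simp
qed

section \<open>Sums over the permutation orbit\<close>

lemma finite_coord_perms: "finite (coord_perms \<tau>)"
proof -
  have "coord_perms \<tau> = (\<lambda>\<pi>. \<chi> i. \<tau> $ \<pi> i) ` {\<pi>. \<pi> permutes UNIV}"
    by (auto simp: coord_perms_def)
  then show ?thesis by (simp add: finite_permutations)
qed

lemma coord_perms_nonempty: "coord_perms \<tau> \<noteq> {}"
  using permutes_id[of UNIV] unfolding coord_perms_def by blast

text \<open>Permuting coordinates maps the orbit bijectively to itself, with inverse given by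
  \<open>inv \<sigma>\<close>. The orbit is a set, so repeated coordinates of \<open>\<tau>\<close>
  cause no multiplicities.\<close>

lemma sum_coord_perms_permute:
  fixes \<tau> :: "real^'t"
  assumes \<sigma>: "\<sigma> permutes UNIV"
  shows "(\<Sum>v\<in>coord_perms \<tau>. f (\<chi> i. v $ \<sigma> i)) = (\<Sum>v\<in>coord_perms \<tau>. f v)"
proof (rule sum.reindex_bij_witness[where i = "\<lambda>v. \<chi> i. v $ inv \<sigma> i" and j = "\<lambda>v. \<chi> i. v $ \<sigma> i"])
  have closed: "(\<chi> i. v $ \<rho> i) \<in> coord_perms \<tau>"
    if "v \<in> coord_perms \<tau>" and \<rho>: "\<rho> permutes UNIV" for v and \<rho> :: "'t \<Rightarrow> 't"
  proof -
    obtain \<pi> where "v = (\<chi> i. \<tau> $ \<pi> i)" "\<pi> permutes UNIV"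
      using \<open>v \<in> coord_perms \<tau>\<close> by (auto simp: coord_perms_def)
    then have "(\<chi> i. v $ \<rho> i) = (\<chi> i. \<tau> $ (\<pi> \<circ> \<rho>) i)" "(\<pi> \<circ> \<rho>) permutes UNIV"
      using permutes_compose[OF \<rho>] by auto
    then show ?thesis unfolding coord_perms_def by blast
  qed
  show "(\<chi> i. v $ \<sigma> i) \<in> coord_perms \<tau>" "(\<chi> i. v $ inv \<sigma> i) \<in> coord_perms \<tau>"
    if "v \<in> coord_perms \<tau>" for v
    using closed[OF that] \<sigma> permutes_inv by blast+
qed (use permutes_inverses[OF \<sigma>] in \<open>simp_all add: vec_eq_iff\<close>)

text \<open>The second moment matrix of the permutation orbit is \<open>a I + b J\<close>, and the
  hypothesis on \<open>M\<close> says that \<open>M\<close> is orthogonal to \<open>J\<close>.\<close>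

lemma sum_coord_perms_quadratic:
  fixes \<tau> :: "real^'t"
  assumes t: "CARD('t) \<ge> 2"
  obtains a where "0 \<le> a"
    and "\<And>M :: real^'t^'t. 1 \<bullet> (M *v 1) = 0 \<Longrightarrow>
      (\<Sum>v\<in>coord_perms \<tau>. v \<bullet> (M *v v)) = a * trace M"
proof -
  define m where "m i j = (\<Sum>v\<in>coord_perms \<tau>. v $ i * v $ j)" for i j
  have perm: "m (\<sigma> i) (\<sigma> j) = m i j" if "\<sigma> permutes UNIV" for \<sigma> i j
    using sum_coord_perms_permute[OF that, of "\<lambda>v. v $ i * v $ j" \<tau>] by (simp add: m_def)
  have swap: "m (Transposition.transpose k l i) (Transposition.transpose k l j) = m i j" for i j k l
    by (rule perm) (simp add: permutes_swap_id)
  obtain i0 j0 :: 't where ne: "i0 \<noteq> j0"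
    using t card_le_Suc0_iff_eq[of "UNIV :: 't set"] by force
  define a where "a = m i0 i0 - m i0 j0"
  have diag: "m i i = m i0 i0" for i
    using swap[of i i0 i i] by simp
  have offdiag: "m i j = m i0 j0" if "i \<noteq> j" for i j
  proof -
    \<comment> \<open>Two transpositions carry the pair \<open>(i, j)\<close> to
      \<open>(i0, j0)\<close>: the first sends \<open>i\<close> to \<open>i0\<close> and
      \<open>j\<close> to \<open>j'\<close>, the second sends \<open>j'\<close> to \<open>j0\<close>
      and fixes \<open>i0\<close>.\<close>
    define j' where "j' = Transposition.transpose i i0 j"
    have "j' \<noteq> i0"
      using that by (auto simp: j'_def transpose_eq_iff)
    then have "m i0 j0 = m i0 j'"
      using swap[of j' j0 i0 j'] ne by simp
    also have "\<dots> = m i j"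
      using swap[of i i0 i j] by (simp add: j'_def)
    finally show ?thesis ..
  qed
  \<comment> \<open>This sum of squares equals \<open>2 * a\<close>.\<close>
  have "0 \<le> (\<Sum>v\<in>coord_perms \<tau>. (v $ i0 - v $ j0)\<^sup>2)"
    by (intro sum_nonneg) simp
  also have "\<dots> = m i0 i0 + m j0 j0 - 2 * m i0 j0"
    by (simp add: m_def power2_eq_square algebra_simps sum.distrib sum_subtractf sum_distrib_left)
  finally have "0 \<le> a"
    using diag[of j0] by (simp add: a_def)
  moreover have "(\<Sum>v\<in>coord_perms \<tau>. v \<bullet> (M *v v)) = a * trace M"
    if M: "1 \<bullet> (M *v 1) = 0" for M :: "real^'t^'t"
  proof -
    have "(\<Sum>v\<in>coord_perms \<tau>. v \<bullet> (M *v v)) =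
        (\<Sum>v\<in>coord_perms \<tau>. \<Sum>i\<in>UNIV. \<Sum>j\<in>UNIV. M $ i $ j * (v $ i * v $ j))"
      by (simp add: inner_vec_def matrix_vector_mult_def sum_distrib_left mult_ac)
    also have "\<dots> = (\<Sum>i\<in>UNIV. \<Sum>v\<in>coord_perms \<tau>. \<Sum>j\<in>UNIV. M $ i $ j * (v $ i * v $ j))"
      by (rule sum.swap)
    also have "\<dots> = (\<Sum>i\<in>UNIV. \<Sum>j\<in>UNIV. M $ i $ j * m i j)"
      unfolding m_def sum_distrib_left by (intro sum.cong sum.swap refl)
    also have "\<dots> = (\<Sum>i\<in>UNIV. \<Sum>j\<in>UNIV. M $ i $ j * m i0 j0 + (if i = j then M $ i $ j * a else 0))"
    proof (intro sum.cong refl)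
      fix i j
      show "M $ i $ j * m i j = M $ i $ j * m i0 j0 + (if i = j then M $ i $ j * a else 0)"
        using diag[of i] offdiag[of i j] by (cases "i = j") (simp_all add: a_def algebra_simps)
    qed
    \<comment> \<open>The constant part of the moments multiplies the sum of all entries of
      \<open>M\<close>, which is zero by assumption.\<close>
    also have "\<dots> = (1 \<bullet> (M *v 1)) * m i0 j0 + a * trace M"
    proof -
      have "(\<Sum>i\<in>UNIV. \<Sum>j\<in>UNIV. M $ i $ j * m i0 j0) = (1 \<bullet> (M *v 1)) * m i0 j0"
        by (simp add: inner_vec_def matrix_vector_mult_def sum_distrib_right)
      moreover have "(\<Sum>i\<in>UNIV. \<Sum>j\<in>UNIV. if i = j then M $ i $ j * a else 0) = a * trace M"
        by (simp add: trace_def sum_distrib_left mult.commute)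
      ultimately show ?thesis
        by (simp only: sum.distrib)
    qed
    finally show ?thesis
      by (simp add: M)
  qed
  ultimately show thesis
    by (rule that)
qed

section \<open>The information blocks as bilinear forms\<close>

lemma Ahat_seq_bilinear:
  "v \<bullet> (Ahat_seq \<Sigma> lam0 s i j *v w) =
    ((Gmat lam0 s i ** centering_mat) *v v) \<bullet> (Btilde \<Sigma> *v ((Gmat lam0 s j ** centering_mat) *v w))"
proof -
  have "Ahat_seq \<Sigma> lam0 s i j =
      transpose (Gmat lam0 s i ** centering_mat) ** Btilde \<Sigma> ** (Gmat lam0 s j ** centering_mat)"
    by (simp add: Ahat_seq_def matrix_transpose_mul transpose_centering_mat matrix_mul_assoc)
  then show ?thesis
    by (simp add: inner_transpose_mult matrix_vector_mul_assoc[symmetric]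
        del: transpose_matrix_vector)
qed

text \<open>Up to the factor \<open>n\<close>, a block is a covariance under the weights
  \<open>P\<close>: a mean of products minus the product of the means.\<close>

lemma A_block_bilinear:
  fixes \<Sigma> :: "('p::{finite,linorder}, 'p) rmat" and P :: "('p \<Rightarrow> 't::finite) \<Rightarrow> real"
    and lam0 :: real
  defines "g \<equiv> \<lambda>i s w. (Gmat lam0 s i ** centering_mat) *v w"
  shows "v \<bullet> (A_block \<Sigma> lam0 n P i j *v w) =
    real n * ((\<Sum>s\<in>UNIV. P s * (g i s v \<bullet> (Btilde \<Sigma> *v g j s w)))
      - (\<Sum>s\<in>UNIV. P s *\<^sub>R g i s v) \<bullet> (Btilde \<Sigma> *v (\<Sum>s\<in>UNIV. P s *\<^sub>R g j s w)))"
proof -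
  have mean: "Gmean lam0 P i *v w = (\<Sum>s\<in>UNIV. P s *\<^sub>R g i s w)" for i w
    by (simp add: Gmean_def g_def sum_mult_vector scaleR_matrix_vector_assoc[symmetric])
  have quad: "v \<bullet> ((transpose (Gmean lam0 P i) ** Btilde \<Sigma> ** Gmean lam0 P j) *v w) =
      (Gmean lam0 P i *v v) \<bullet> (Btilde \<Sigma> *v (Gmean lam0 P j *v w))"
    by (simp add: inner_transpose_mult matrix_vector_mul_assoc[symmetric]
        del: transpose_matrix_vector)
  show ?thesis
    by (simp add: A_block_def Ahat_design_def matrix_vector_mult_diff_rdistrib
        scaleR_matrix_vector_assoc[symmetric]
        sum_mult_vector inner_diff_right inner_sum_right Ahat_seq_bilinear right_diff_distrib
        quad mean) (simp add: g_def)
qed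

lemma transpose_A_block:
  assumes "transpose \<Sigma> = \<Sigma>" "pos_def \<Sigma>"
  shows "transpose (A_block \<Sigma> lam0 n P i j) = A_block \<Sigma> lam0 n P j i"
proof (rule matrix_eq_bilinear)
  fix x y
  note sym = inner_mult_symmetric[OF transpose_Btilde[OF assms]]
  have "x \<bullet> (transpose (A_block \<Sigma> lam0 n P i j) *v y) = y \<bullet> (A_block \<Sigma> lam0 n P i j *v x)"
    by (simp only: inner_transpose_mult) (simp add: inner_commute)
  also have "\<dots> = x \<bullet> (A_block \<Sigma> lam0 n P j i *v y)"
    unfolding A_block_bilinear by (subst sym, subst (2) sym) (rule refl)
  finally show "x \<bullet> (transpose (A_block \<Sigma> lam0 n P i j) *v y) = x \<bullet> (A_block \<Sigma> lam0 n P j i *v y)" .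
qed

text \<open>The three terms of \<open>f\<close> combine into \<open>n\<close> times the variance of
  \<open>g 1 s v + g 2 s w\<close> under \<open>P\<close>. It is nonnegative, and with
  \<open>w = x *\<^sub>R v\<close> it is at most the second moment.\<close>

lemma A_block_form:
  fixes \<Sigma> :: "('p::{finite,linorder}, 'p) rmat" and P :: "('p \<Rightarrow> 't::finite) \<Rightarrow> real"
    and lam0 :: real and n :: nat
  assumes \<Sigma>: "transpose \<Sigma> = \<Sigma>" "pos_def \<Sigma>" and P: "is_design P"
  defines "f \<equiv> \<lambda>v w. v \<bullet> (A_block \<Sigma> lam0 n P 1 1 *v v) + 2 * (v \<bullet> (A_block \<Sigma> lam0 n P 1 2 *v w))
      + w \<bullet> (A_block \<Sigma> lam0 n P 2 2 *v w)"
  shows "0 \<le> f v w"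
    and "f v (x *\<^sub>R v) \<le> v \<bullet> ((real n *\<^sub>R (\<Sum>s\<in>UNIV. P s *\<^sub>R (Ahat_seq \<Sigma> lam0 s 1 1
      + (2 * x) *\<^sub>R Ahat_seq \<Sigma> lam0 s 1 2 + x\<^sup>2 *\<^sub>R Ahat_seq \<Sigma> lam0 s 2 2))) *v v)"
proof -
  let ?B = "Btilde \<Sigma>"
  define g where "g i s w = (Gmat lam0 s i ** centering_mat) *v w" for i w and s :: "'p \<Rightarrow> 't"
  note sym = inner_mult_symmetric[OF transpose_Btilde[OF \<Sigma>]]
  have sq: "a \<bullet> (?B *v a) + 2 * (a \<bullet> (?B *v b)) + b \<bullet> (?B *v b) = (a + b) \<bullet> (?B *v (a + b))" for a b
    using sym[of b a] by (simp add: matrix_vector_right_distrib inner_add_left inner_add_right)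
  have form: "f v w = real n * ((\<Sum>s\<in>UNIV. P s * ((g 1 s v + g 2 s w) \<bullet> (?B *v (g 1 s v + g 2 s w))))
      - (\<Sum>s\<in>UNIV. P s *\<^sub>R (g 1 s v + g 2 s w)) \<bullet> (?B *v (\<Sum>s\<in>UNIV. P s *\<^sub>R (g 1 s v + g 2 s w))))"
    for v w
    unfolding f_def A_block_bilinear
    by (simp add: g_def[symmetric] sq[symmetric] scaleR_right_distrib sum.distrib distrib_left
        right_diff_distrib sum_distrib_left mult_ac)
  have P': "(\<Sum>s\<in>UNIV. P s) = 1" "\<And>s. 0 \<le> P s"
    using P by (auto simp: is_design_def)
  show "0 \<le> f v w"
    unfolding form
    using weighted_covariance[OF transpose_Btilde[OF \<Sigma>] Btilde_nonneg[OF \<Sigma>] P',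
        where g = "\<lambda>s. g 1 s v + g 2 s w"]
    by simp
  have "f v (x *\<^sub>R v) \<le>
      real n * (\<Sum>s\<in>UNIV. P s * ((g 1 s v + g 2 s (x *\<^sub>R v)) \<bullet> (?B *v (g 1 s v + g 2 s (x *\<^sub>R v)))))"
    unfolding form by (intro mult_left_mono) (simp_all add: Btilde_nonneg[OF \<Sigma>])
  also have "\<dots> = v \<bullet> ((real n *\<^sub>R (\<Sum>s\<in>UNIV. P s *\<^sub>R (Ahat_seq \<Sigma> lam0 s 1 1
      + (2 * x) *\<^sub>R Ahat_seq \<Sigma> lam0 s 1 2 + x\<^sup>2 *\<^sub>R Ahat_seq \<Sigma> lam0 s 2 2))) *v v)"
    by (simp add: scaleR_matrix_vector_assoc[symmetric] sum_mult_vector inner_sum_right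
        matrix_vector_mult_add_rdistrib
        inner_add_right Ahat_seq_bilinear g_def[symmetric] sq[symmetric])
      (simp add: g_def matrix_vector_mult_scaleR power2_eq_square mult_ac)
  finally show "f v (x *\<^sub>R v) \<le> \<dots>" .
qed

section \<open>Upper bound for every design\<close>

lemma Ahat_seq_one: "Ahat_seq \<Sigma> lam0 s i j *v 1 = 0"
  by (simp add: Ahat_seq_def matrix_vector_mul_assoc[symmetric] centering_mat_one)

lemma criterion_eq_sum:
  "criterion ginv \<Sigma> \<tau> lam0 n P =
    (\<Sum>v\<in>coord_perms \<tau>. v \<bullet> (A_design ginv \<Sigma> lam0 n P *v v)) / card (coord_perms \<tau>)"
  unfolding criterion_def
  by (rule integral_pmf_of_set[OF coord_perms_nonempty finite_coord_perms])

text \<open>The number \<open>x\<close> is free, so each choice of it gives a bound valid for all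
  designs at once. The set \<open>C\<close> stands for a permutation orbit and \<open>a\<close> for
  its trace factor.\<close>

lemma sum_A_design_le:
  fixes \<Sigma> :: "('p::{finite,linorder}, 'p) rmat" and Q :: "('p \<Rightarrow> 't::finite) \<Rightarrow> real"
    and C :: "(real, 't) vec set"
  assumes \<Sigma>: "transpose \<Sigma> = \<Sigma>" "pos_def \<Sigma>" and Q: "is_design Q"
    and ginv: "\<And>M. is_ginverse M (ginv M)"
    and a: "0 \<le> a" "\<And>M :: ('t, 't) rmat. 1 \<bullet> (M *v 1) = 0 \<Longrightarrow> (\<Sum>v\<in>C. v \<bullet> (M *v v)) = a * trace M"
  shows "(\<Sum>v\<in>C. v \<bullet> (A_design ginv \<Sigma> lam0 n Q *v v)) \<le> a * (real n * r_max TYPE('t) \<Sigma> lam0 x)"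
proof -
  define M where "M = real n *\<^sub>R (\<Sum>s\<in>UNIV. Q s *\<^sub>R (Ahat_seq \<Sigma> lam0 s 1 1
      + (2 * x) *\<^sub>R Ahat_seq \<Sigma> lam0 s 1 2 + x\<^sup>2 *\<^sub>R Ahat_seq \<Sigma> lam0 s 2 2))"
  have "(\<Sum>v\<in>C. v \<bullet> (A_design ginv \<Sigma> lam0 n Q *v v)) \<le> (\<Sum>v\<in>C. v \<bullet> (M *v v))"
  proof (rule sum_mono)
    fix v
    \<comment> \<open>Choosing \<open>w = x *\<^sub>R v\<close> keeps the bound a quadratic form in
      \<open>v\<close> alone, so its sum over \<open>C\<close> reduces to a trace.\<close>
    note schur_complement_le[OF transpose_A_block[OF \<Sigma>] transpose_A_block[OF \<Sigma>]
        A_block_form(1)[OF \<Sigma> Q] ginv, of v lam0 n "x *\<^sub>R v"]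
    also note A_block_form(2)[OF \<Sigma> Q, of v lam0 n x]
    finally show "v \<bullet> (A_design ginv \<Sigma> lam0 n Q *v v) \<le> v \<bullet> (M *v v)"
      unfolding A_design_def M_def .
  qed
  also have "\<dots> = a * trace M"
    by (rule a(2)) (simp add: M_def scaleR_matrix_vector_assoc[symmetric] sum_mult_vector
        matrix_vector_mult_add_rdistrib Ahat_seq_one)
  also have "trace M = real n * (\<Sum>s\<in>UNIV. Q s * r_seq \<Sigma> lam0 s x)"
    by (simp add: M_def trace_scaleR trace_sum trace_add r_seq_def h_seq_def mult_ac)
  \<comment> \<open>A weighted mean is at most the maximum.\<close>
  also have "(\<Sum>s\<in>UNIV. Q s * r_seq \<Sigma> lam0 s x) \<le> (\<Sum>s\<in>UNIV. Q s * r_max TYPE('t) \<Sigma> lam0 x)"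
    using Q by (intro sum_mono mult_left_mono) (auto simp: is_design_def r_max_def)
  also have "\<dots> = r_max TYPE('t) \<Sigma> lam0 x"
    using Q by (simp add: is_design_def flip: sum_distrib_right)
  finally show ?thesis
    using a(1) by (simp add: mult_left_mono)
qed

section \<open>Attainment of the bound\<close>

theorem theorem10:
  fixes \<Sigma> :: "('p::{finite,linorder}, 'p) rmat"
    and ginv :: "('t::finite, 't) rmat \<Rightarrow> ('t, 't) rmat"
    and n :: nat
    and lam0 x0 y0 :: real
    and P :: "('p \<Rightarrow> 't) \<Rightarrow> real"
  assumes p: "CARD('p) \<ge> 2"
    and t: "CARD('t) \<ge> 2"
    and n: "n \<ge> 1"
    and \<Sigma>_sym: "transpose \<Sigma> = \<Sigma>"
    and \<Sigma>_pos: "pos_def \<Sigma>"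
    and ginv: "\<And>M. is_ginverse M (ginv M)"
    and y0_min: "y0 \<in> range (r_max TYPE('t) \<Sigma> lam0)" "\<And>x. y0 \<le> r_max TYPE('t) \<Sigma> lam0 x"
    and x0: "r_max TYPE('t) \<Sigma> lam0 x0 = y0"
    and x0_unique: "\<And>x. r_max TYPE('t) \<Sigma> lam0 x = y0 \<Longrightarrow> x = x0"
    and design: "is_design P"
    and eq1: "(\<Sum>s\<in>R_seqs \<Sigma> lam0 x0 y0.
                 P s *\<^sub>R (Ahat_seq \<Sigma> lam0 s 1 1 + x0 *\<^sub>R Ahat_seq \<Sigma> lam0 s 1 2))
              = (y0 / (real CARD('t) - 1)) *\<^sub>R centering_mat"
    and eq2: "(\<Sum>s\<in>R_seqs \<Sigma> lam0 x0 y0.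
                 P s *\<^sub>R (Ahat_seq \<Sigma> lam0 s 2 1 + x0 *\<^sub>R Ahat_seq \<Sigma> lam0 s 2 2)) = 0"
    and eq3: "(\<Sum>s\<in>R_seqs \<Sigma> lam0 x0 y0.
                 P s *\<^sub>R (Btilde \<Sigma> **
                   (carryover_mat s + x0 *\<^sub>R (treatment_mat s + lam0 *\<^sub>R carryover_mat s)) **
                   centering_mat)) = 0"
    and eq4: "(\<Sum>s\<in>R_seqs \<Sigma> lam0 x0 y0. P s) = 1"
    and supp: "\<And>s. s \<notin> R_seqs \<Sigma> lam0 x0 y0 \<Longrightarrow> P s = 0"
  shows "\<forall>\<tau>0 Q. is_design Q \<longrightarrow>
           criterion ginv \<Sigma> \<tau>0 lam0 n Q \<le> criterion ginv \<Sigma> \<tau>0 lam0 n P"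
proof (intro allI impI)
  fix \<tau>0 :: "(real, 't) vec" and Q :: "('p \<Rightarrow> 't) \<Rightarrow> real"
  assume Q: "is_design Q"
  let ?A = "A_block \<Sigma> lam0 n P"
  have UNIV_eq: "(\<Sum>s\<in>UNIV. P s *\<^sub>R f s) = (\<Sum>s\<in>R_seqs \<Sigma> lam0 x0 y0. P s *\<^sub>R f s)"
    for f :: "('p \<Rightarrow> 't) \<Rightarrow> ('a::real_vector)"
    by (rule sum.mono_neutral_right) (auto simp: supp)
  \<comment> \<open>\<open>eq3\<close> in terms of the means: the columns of
    \<open>Gmean lam0 P 1 + x0 *\<^sub>R Gmean lam0 P 2\<close> lie in the kernel of
    \<open>Btilde \<Sigma>\<close>.\<close>
  have mean: "Btilde \<Sigma> ** Gmean lam0 P 1 + x0 *\<^sub>R (Btilde \<Sigma> ** Gmean lam0 P 2) = 0"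
    using eq3[unfolded UNIV_eq[symmetric]]
    by (simp add: Gmean_def matrix_eq sum_mult_vector scaleR_matrix_vector_assoc[symmetric]
        matrix_vector_mul_assoc[symmetric] matrix_vector_mult_add_rdistrib Gmat_def
        linear_sum[OF matrix_vector_mul_linear] matrix_vector_mult_scaleR
        matrix_vector_right_distrib sum.distrib scaleR_right_distrib scaleR_sum_right mult_ac)
  have comb: "?A i 1 + x0 *\<^sub>R ?A i 2 =
      real n *\<^sub>R (\<Sum>s\<in>UNIV. P s *\<^sub>R (Ahat_seq \<Sigma> lam0 s i 1 + x0 *\<^sub>R Ahat_seq \<Sigma> lam0 s i 2))" for i
  proof -
    \<comment> \<open>The two mean corrections share the left factor
      \<open>transpose (Gmean lam0 P i)\<close>; what remains on the right is zero by
      \<open>mean\<close>.\<close>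
    have "?A i 1 + x0 *\<^sub>R ?A i 2 =
        real n *\<^sub>R (\<Sum>s\<in>UNIV. P s *\<^sub>R (Ahat_seq \<Sigma> lam0 s i 1 + x0 *\<^sub>R Ahat_seq \<Sigma> lam0 s i 2))
        - real n *\<^sub>R (transpose (Gmean lam0 P i) **
            (Btilde \<Sigma> ** Gmean lam0 P 1 + x0 *\<^sub>R (Btilde \<Sigma> ** Gmean lam0 P 2)))"
      by (simp add: A_block_def Ahat_design_def matrix_add_ldistrib matrix_mul_assoc
          matrix_scalar_ac scalar_matrix_assoc[symmetric] scaleR_right_distrib
          scaleR_right_diff_distrib sum.distrib
          scaleR_sum_right mult_ac)
    then show ?thesis
      unfolding mean by simp
  qed
  define c where "c = real n * (y0 / (real CARD('t) - 1))"
  have A1: "?A 1 1 + x0 *\<^sub>R ?A 1 2 = c *\<^sub>R centering_mat"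
    unfolding comb UNIV_eq eq1 by (simp add: c_def)
  have A2: "?A 2 1 = - x0 *\<^sub>R ?A 2 2"
    using comb[of 2] unfolding UNIV_eq eq2 scaleR_minus_left
    by (intro eq_neg_iff_add_eq_0[THEN iffD2]) simp
  have A3: "?A 1 2 = - x0 *\<^sub>R ?A 2 2"
    using arg_cong[OF A2, of transpose]
    by (simp only: transpose_scalar transpose_A_block[OF \<Sigma>_sym \<Sigma>_pos])
  have scale: "(b *\<^sub>R M) ** X ** (b *\<^sub>R M) = (b * b) *\<^sub>R (M ** X ** M)"
    for b and M X :: "('t, 't) rmat"
    by (simp add: matrix_scalar_ac scalar_matrix_assoc[symmetric])
  \<comment> \<open>Both off-diagonal blocks are \<open>- x0 *\<^sub>R ?A 2 2\<close>, so the
    defining identity of a generalized inverse evaluates the product, whichever inverse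
    \<open>ginv\<close> picks. The Schur complement then collapses to
    \<open>?A 1 1 + x0 *\<^sub>R ?A 1 2\<close>.\<close>
  have "?A 1 2 ** ginv (?A 2 2) ** ?A 2 1 = (x0 * x0) *\<^sub>R ?A 2 2"
    unfolding A2 A3 scale using ginv[of "?A 2 2"] by (simp add: is_ginverse_def)
  moreover have "x0 *\<^sub>R ?A 1 2 = - ((x0 * x0) *\<^sub>R ?A 2 2)"
    unfolding A3 by simp
  ultimately have AP: "A_design ginv \<Sigma> lam0 n P = c *\<^sub>R centering_mat"
    unfolding A_design_def A1[symmetric] by simp
  \<comment> \<open>The factor \<open>a\<close> depends only on \<open>\<tau>0\<close>, so it serves
    both designs.\<close>
  obtain a where a: "0 \<le> a" "\<And>M :: real^'t^'t. 1 \<bullet> (M *v 1) = 0 \<Longrightarrow>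
      (\<Sum>v\<in>coord_perms \<tau>0. v \<bullet> (M *v v)) = a * trace M"
    by (rule sum_coord_perms_quadratic[OF t, of \<tau>0]) (rule that)
  have "(\<Sum>v\<in>coord_perms \<tau>0. v \<bullet> (A_design ginv \<Sigma> lam0 n Q *v v)) \<le> a * (real n * y0)"
    using sum_A_design_le[OF \<Sigma>_sym \<Sigma>_pos Q ginv a, of lam0 n x0] by (simp add: x0)
  \<comment> \<open>The trace \<open>t - 1\<close> of the centering matrix cancels the denominator
    in \<open>c\<close>.\<close>
  also have "\<dots> = a * trace (A_design ginv \<Sigma> lam0 n P)"
    using t by (simp add: AP trace_scaleR trace_centering_mat c_def)
  also have "\<dots> = (\<Sum>v\<in>coord_perms \<tau>0. v \<bullet> (A_design ginv \<Sigma> lam0 n P *v v))"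
    by (rule a(2)[symmetric]) (simp add: AP scaleR_matrix_vector_assoc[symmetric] centering_mat_one)
  finally show "criterion ginv \<Sigma> \<tau>0 lam0 n Q \<le> criterion ginv \<Sigma> \<tau>0 lam0 n P"
    unfolding criterion_eq_sum by (rule divide_right_mono) simp
qed

end
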